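(* Let $c>0$ and $\lambda>0$. The probability density of the process $W_1(t)=B\left(c^2\mathcal{L}^{1/2}(t)\right)$, $t>0$, can be written as $$w^1_{1/2}(x,t)=\frac{\lambda}{c\pi}\int_0^t\frac{1}{\sqrt{s(t-s)}}\,e^{-\frac{x^2}{4c^2s}-\frac{\lambda^2s^2}{t-s}}\left[\frac{s}{2(t-s)}+1\right]ds,\qquad x\in\mathbb{R},\ t>0.$$
   Context: $B$ is a one-dimensional Brownian motion normalized so that $\mathbb{E}e^{i\xi B(t)}=e^{-t\xi^2}$ (variance $2t$), independent of $\mathcal{L}^{1/2}$. $H^{1/2}(t)$, $t>0$, is the stable subordinator of order $\frac12$ with $\mathbb{E}e^{-\mu H^{1/2}(t)}=e^{-t\sqrt\mu}$, $\mu>0$; $\mathcal{H}^{1/2}(t)=t+(2\lambda)^2H^{1/2}(t)$; and $\mathcal{L}^{1/2}(t)=\inf\{s>0:\mathcal{H}^{1/2}(s)\ge t\}$, $t>0$. *)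

theory Defs
  imports "HOL-Probability.Probability"
begin

text \<open>Processes are indexed by real time; only nonnegative times are constrained.\<close>

definition indep_increments :: "'a measure \<Rightarrow> (real \<Rightarrow> 'a \<Rightarrow> real) \<Rightarrow> bool" where
  "indep_increments M X \<longleftrightarrow>
     (\<forall>(n::nat) (\<tau>::nat \<Rightarrow> real). 0 \<le> \<tau> 0 \<and> (\<forall>i<n. \<tau> i < \<tau> (Suc i)) \<longrightarrow>
        prob_space.indep_vars M (\<lambda>_. borel) (\<lambda>i \<omega>. X (\<tau> (Suc i)) \<omega> - X (\<tau> i) \<omega>) {..<n})"

definition stationary_increments :: "'a measure \<Rightarrow> (real \<Rightarrow> 'a \<Rightarrow> real) \<Rightarrow> bool" where
  "stationary_increments M X \<longleftrightarrow>
     (\<forall>s\<ge>0. \<forall>h\<ge>0. distr M borel (\<lambda>\<omega>. X (s + h) \<omega> - X s \<omega>) = distr M borel (X h))"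

text \<open>Brownian motion started at 0, with an unspecified variance parameter, all of whose paths
  are continuous.\<close>

definition brownian_motion :: "'a measure \<Rightarrow> (real \<Rightarrow> 'a \<Rightarrow> real) \<Rightarrow> bool" where
  "brownian_motion M B \<longleftrightarrow>
     (\<forall>t\<ge>0. B t \<in> borel_measurable M) \<and>
     (\<forall>\<omega>\<in>space M. B 0 \<omega> = 0) \<and>
     indep_increments M B \<and>
     (\<exists>v>0. \<forall>s\<ge>0. \<forall>t>s.
        distributed M lborel (\<lambda>\<omega>. B t \<omega> - B s \<omega>) (normal_density 0 (sqrt (v * (t - s))))) \<and>
     (\<forall>\<omega>\<in>space M. continuous_on {0..} (\<lambda>t. B t \<omega>))"

text \<open>Left limits exist automatically, since the paths are finite and nondecreasing.\<close>

definition subordinator :: "'a measure \<Rightarrow> (real \<Rightarrow> 'a \<Rightarrow> real) \<Rightarrow> bool" where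
  "subordinator M H \<longleftrightarrow>
     (\<forall>t\<ge>0. H t \<in> borel_measurable M) \<and>
     (\<forall>\<omega>\<in>space M. H 0 \<omega> = 0) \<and>
     indep_increments M H \<and>
     stationary_increments M H \<and>
     (\<forall>\<omega>\<in>space M. mono_on {0..} (\<lambda>t. H t \<omega>)) \<and>
     (\<forall>\<omega>\<in>space M. \<forall>t\<ge>0. continuous (at_right t) (\<lambda>u. H u \<omega>))"

definition drifted :: "real \<Rightarrow> (real \<Rightarrow> 'a \<Rightarrow> real) \<Rightarrow> real \<Rightarrow> 'a \<Rightarrow> real" where
  "drifted lam H t \<omega> = t + (2 * lam)\<^sup>2 * H t \<omega>"

definition hitting_time :: "(real \<Rightarrow> 'a \<Rightarrow> real) \<Rightarrow> real \<Rightarrow> 'a \<Rightarrow> real" where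
  "hitting_time X t \<omega> = Inf {s. s > 0 \<and> X s \<omega> \<ge> t}"

text \<open>Independence of two whole processes: of the path-valued random variables with respect to
  the product sigma-algebras.\<close>

definition indep_processes ::
  "'a measure \<Rightarrow> real set \<Rightarrow> (real \<Rightarrow> 'a \<Rightarrow> real) \<Rightarrow> real set \<Rightarrow> (real \<Rightarrow> 'a \<Rightarrow> real) \<Rightarrow> bool" where
  "indep_processes M S X T Y \<longleftrightarrow>
     prob_space.indep_var M
       (PiM S (\<lambda>_. borel)) (\<lambda>\<omega>. \<lambda>s\<in>S. X s \<omega>)
       (PiM T (\<lambda>_. borel)) (\<lambda>\<omega>. \<lambda>t\<in>T. Y t \<omega>)"

definition w1_integrand :: "real \<Rightarrow> real \<Rightarrow> real \<Rightarrow> real \<Rightarrow> real \<Rightarrow> real" where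
  "w1_integrand c lam x t s =
     1 / sqrt (s * (t - s)) * exp (- (x\<^sup>2 / (4 * c\<^sup>2 * s)) - lam\<^sup>2 * s\<^sup>2 / (t - s))
       * (s / (2 * (t - s)) + 1)"

definition w1 :: "real \<Rightarrow> real \<Rightarrow> real \<Rightarrow> real \<Rightarrow> real" where
  "w1 c lam x t = lam / (c * pi) * (LINT s:{0<..<t}|lborel. w1_integrand c lam x t s)"

end

(* Conditionally on the random time, the process at time t is centred Gaussian with variance
   2 c^2 L(t), so its density is a Gaussian mixture over the law of L(t).  Since L(t) > s holds iff
   H(s) < (t - s) / (2 lam)^2, that law follows from the law of H(s), which is the Levy law because
   both have the same Laplace transform.  For the mixture itself, characteristic functions are
   compared. *)

theory Submission
  imports Defs
begin

section \<open>The standard normal distribution function\<close>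

text \<open>The explicit one-dimensional integrals rest on antiderivatives built from the normal
  distribution function. For the Levy law, one closed-form antiderivative of the exponentially
  tilted density yields the transform, the total mass and the distribution function together.
  Inversion of the Laplace transform is avoided: \<open>exp (- x)\<close> carries laws on the half
  line to laws on the unit interval, which are determined by their moments. The delicate point is
  the random substitution \<open>B (\<tau> \<omega>) \<omega>\<close>: measurability of each
  \<open>B s\<close> alone gives neither its measurability nor its law. Path continuity settles
  both, and no conditional distribution is ever formed; the identity E exp(i xi B(tau)) = E exp(-tau
  xi^2) takes the place of conditioning, and the Gaussian mixture has the same transform by
  Fubini.\<close>

lemma interval_FTC_nonneg:
  fixes f F :: "real \<Rightarrow> real" and a b :: ereal
  assumes "a < b"
    and F: "\<And>x. a < ereal x \<Longrightarrow> ereal x < b \<Longrightarrow> (F has_real_derivative f x) (at x)"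
    and f: "\<And>x. a < ereal x \<Longrightarrow> ereal x < b \<Longrightarrow> isCont f x"
    and nonneg: "\<And>x. a < ereal x \<Longrightarrow> ereal x < b \<Longrightarrow> 0 \<le> f x"
    and A: "((F \<circ> real_of_ereal) \<longlongrightarrow> A) (at_right a)"
    and B: "((F \<circ> real_of_ereal) \<longlongrightarrow> B) (at_left b)"
  shows "has_bochner_integral lborel (\<lambda>x. indicator (einterval a b) x * f x) (B - A)"
proof -
  have "AE x in lborel. a < ereal x \<longrightarrow> ereal x < b \<longrightarrow> 0 \<le> f x"
    using nonneg by auto
  \<comment> \<open>For a nonnegative integrand, finite endpoint limits of the antiderivative give
    integrability along with the value. This is what admits singular endpoints and unbounded
    intervals below.\<close>
  note FTC = interval_integral_FTC_nonneg[OF \<open>a < b\<close> F f this A B]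
  show ?thesis
    using FTC less_imp_le[OF \<open>a < b\<close>]
    by (simp add: has_bochner_integral_iff set_integrable_def interval_lebesgue_integral_def
        set_lebesgue_integral_def)
qed

definition std_normal_cdf :: "real \<Rightarrow> real" where
  "std_normal_cdf = cdf std_normal_distribution"

lemma std_normal_cdf_at_top: "(std_normal_cdf \<longlongrightarrow> 1) at_top"
proof -
  interpret real_distribution std_normal_distribution by (rule real_dist_normal_dist)
  show ?thesis unfolding std_normal_cdf_def by (rule cdf_lim_at_top_prob)
qed

lemma std_normal_cdf_at_bot: "(std_normal_cdf \<longlongrightarrow> 0) at_bot"
proof -
  interpret real_distribution std_normal_distribution by (rule real_dist_normal_dist)
  interpret finite_borel_measure std_normal_distribution by (rule finite_borel_measure_M)
  show ?thesis unfolding std_normal_cdf_def by (rule cdf_lim_at_bot)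
qed

lemma std_normal_cdf_nonneg: "0 \<le> std_normal_cdf x"
  by (simp add: std_normal_cdf_def cdf_def)

text \<open>Bridge from the measure-theoretic \<open>cdf\<close> to the gauge integral over a closed
  interval, the form that the fundamental theorem differentiates; the left endpoint is a null
  set.\<close>

lemma std_normal_cdf_diff:
  assumes "a \<le> x"
  shows "std_normal_cdf x - std_normal_cdf a = integral {a..x} std_normal_density"
proof (cases "a = x")
  case False
  interpret real_distribution std_normal_distribution by (rule real_dist_normal_dist)
  interpret finite_borel_measure std_normal_distribution by (rule finite_borel_measure_M)
  have "set_integrable lborel {a..x} std_normal_density"
    unfolding set_integrable_def by (intro integrable_mult_indicator integrable_normal_density) auto
  then have int: "(LINT y:{a..x}|lborel. std_normal_density y) = integral {a..x} std_normal_density"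
    by (rule set_borel_integral_eq_integral)
  have "std_normal_cdf x - std_normal_cdf a = measure std_normal_distribution {a<..x}"
    using False assms cdf_diff_eq[of a x] by (simp add: std_normal_cdf_def)
  also have "\<dots> = (LINT y:{a<..x}|lborel. std_normal_density y)"
    using integral_density[of "indicator {a<..x} :: real \<Rightarrow> real" lborel std_normal_density]
    by (simp add: set_lebesgue_integral_def mult.commute)
  also have "\<dots> = (LINT y:{a..x}|lborel. std_normal_density y)"
    by (rule set_integral_discrete_difference[where X = "{a}"]) auto
  finally show ?thesis
    using int by simp
qed simp

lemma continuous_on_normal_density: "continuous_on S (normal_density \<mu> \<sigma>)"
  unfolding normal_density_def divide_inverse by (intro continuous_intros)

lemma std_normal_cdf_deriv:
  "(std_normal_cdf has_real_derivative std_normal_density x) (at x)"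
proof -
  \<comment> \<open>The base point \<open>x - 1\<close> makes \<open>x\<close> interior to the
    window, so the derivative within the window is a full derivative.\<close>
  have "((\<lambda>y. std_normal_cdf (x - 1) + integral {x - 1..y} std_normal_density)
      has_real_derivative std_normal_density x) (at x within {x - 1..x + 1})"
    using integral_has_real_derivative[OF continuous_on_normal_density[of "{x - 1..x + 1}" 0 1], of x]
    by (auto intro!: derivative_eq_intros)
  then have "(std_normal_cdf has_real_derivative std_normal_density x) (at x within {x - 1..x + 1})"
    by (rule has_field_derivative_transform_within[where d = 1])
       (auto simp: std_normal_cdf_diff[symmetric])
  then show ?thesis
    by (simp add: at_within_Icc_at)
qed

lemma std_normal_cdf_chain [derivative_intros]:
  assumes "(g has_real_derivative g') (at x within S)"
  shows "((\<lambda>x. std_normal_cdf (g x)) has_real_derivative std_normal_density (g x) * g') (at x within S)"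
  using DERIV_chain2[OF std_normal_cdf_deriv assms] .

lemma std_normal_cdf_isCont: "isCont std_normal_cdf x"
  by (rule DERIV_isCont[OF std_normal_cdf_deriv])

text \<open>The density is even, so the sum of the values at \<open>x\<close> and \<open>- x\<close>
  has derivative zero; its limit at infinity is 1.\<close>

lemma std_normal_cdf_zero: "std_normal_cdf 0 = 1 / 2"
proof -
  let ?g = "\<lambda>x. std_normal_cdf x + std_normal_cdf (- x)"
  have "(?g has_real_derivative 0) (at x)" for x
    by (auto intro!: derivative_eq_intros std_normal_cdf_deriv simp: normal_density_def)
  then have const: "?g x = ?g 0" for x
    using DERIV_isconst_all by blast
  have "(?g \<longlongrightarrow> 1 + 0) at_top"
    by (intro tendsto_add std_normal_cdf_at_top
        filterlim_compose[OF std_normal_cdf_at_bot] filterlim_uminus_at_bot_at_top)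
  moreover have "?g = (\<lambda>x. ?g 0)"
    using const by (rule ext)
  ultimately have "((\<lambda>x::real. ?g 0) \<longlongrightarrow> 1) at_top"
    by (metis add_0_right)
  then have "?g 0 = 1"
    by (simp add: tendsto_const_iff)
  then show ?thesis by simp
qed

section \<open>The Levy distribution\<close>

text \<open>With \<open>q = s / sqrt 2\<close> this is the density of \<open>H s\<close>.\<close>

definition levy_density :: "real \<Rightarrow> real \<Rightarrow> real" where
  "levy_density q y =
     indicator {0<..} y * (q / sqrt (2 * pi) / (y * sqrt y) * exp (- (q\<^sup>2 / (2 * y))))"

text \<open>An antiderivative of \<open>levy_density q y * exp (- \<mu> * y)\<close>, where \<open>p = sqrt (2 * \<mu>)\<close>.\<close>

definition levy_antideriv :: "real \<Rightarrow> real \<Rightarrow> real \<Rightarrow> real" where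
  "levy_antideriv p q y = exp (- (p * q)) * std_normal_cdf (p * sqrt y - q / sqrt y)
     + exp (p * q) * std_normal_cdf (- (p * sqrt y) - q / sqrt y)"

lemma levy_density_nonneg: "0 \<le> q \<Longrightarrow> 0 \<le> levy_density q y"
  by (auto simp: levy_density_def indicator_def)

lemma borel_measurable_levy_density [measurable]: "levy_density q \<in> borel_measurable borel"
  unfolding levy_density_def by measurable

text \<open>Completing the square: the squares of the two arguments differ only in the sign of the
  cross term, and the prefactors \<open>exp (- (p * q))\<close> and \<open>exp (p * q)\<close>
  cancel exactly that term. Both summands thus share one Gaussian factor \<open>K\<close>; in the
  inner derivatives the \<open>p\<close> parts cancel and the \<open>q\<close> parts add up.\<close>

lemma levy_antideriv_deriv:
  assumes "0 < y"
  shows "(levy_antideriv p q has_real_derivative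
    q / sqrt (2 * pi) / (y * sqrt y) * exp (- (q\<^sup>2 / (2 * y))) * exp (- (p\<^sup>2 / 2 * y))) (at y)"
proof -
  define r where "r = sqrt y"
  have r: "r > 0" "y = r\<^sup>2" using assms by (auto simp: r_def)
  define K where "K = exp (- (q\<^sup>2 / (2 * y))) * exp (- (p\<^sup>2 / 2 * y)) / sqrt (2 * pi)"
  have e1: "exp (- (p * q)) * std_normal_density (p * r - q / r) = K"
    using r by (simp add: K_def normal_density_def exp_add[symmetric] field_simps power2_eq_square
        flip: exp_minus)
  have e2: "exp (p * q) * std_normal_density (- (p * r) - q / r) = K"
    using r by (simp add: K_def normal_density_def exp_add[symmetric] field_simps power2_eq_square
        flip: exp_minus)
  have u: "((\<lambda>y. p * sqrt y - q / sqrt y) has_real_derivative p / (2 * r) + q / (2 * r ^ 3)) (at y)"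
    using assms r by (auto intro!: derivative_eq_intros simp: field_simps power3_eq_cube power2_eq_square)
  have v: "((\<lambda>y. - (p * sqrt y) - q / sqrt y) has_real_derivative - (p / (2 * r)) + q / (2 * r ^ 3)) (at y)"
    using assms r by (auto intro!: derivative_eq_intros simp: field_simps power3_eq_cube power2_eq_square)
  have "(levy_antideriv p q has_real_derivative
      exp (- (p * q)) * (std_normal_density (p * r - q / r) * (p / (2 * r) + q / (2 * r ^ 3)))
    + exp (p * q) * (std_normal_density (- (p * r) - q / r) * (- (p / (2 * r)) + q / (2 * r ^ 3)))) (at y)"
    unfolding levy_antideriv_def r_def
    by (intro DERIV_add DERIV_cmult std_normal_cdf_chain u[unfolded r_def] v[unfolded r_def])
  also have "exp (- (p * q)) * (std_normal_density (p * r - q / r) * (p / (2 * r) + q / (2 * r ^ 3)))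
    + exp (p * q) * (std_normal_density (- (p * r) - q / r) * (- (p / (2 * r)) + q / (2 * r ^ 3)))
    = K * (q / r ^ 3)"
    unfolding mult.assoc[symmetric] e1 e2 by (simp add: algebra_simps)
  also have "K * (q / r ^ 3) = q / sqrt (2 * pi) / (y * sqrt y) * exp (- (q\<^sup>2 / (2 * y))) * exp (- (p\<^sup>2 / 2 * y))"
    using r by (simp add: K_def power3_eq_cube power2_eq_square field_simps)
  finally show ?thesis .
qed

lemma filterlim_divide_sqrt_at_right_0:
  assumes "0 < q"
  shows "filterlim (\<lambda>y. q / sqrt y) at_top (at_right 0)"
proof -
  have "filterlim sqrt (at_right 0) (at_right 0)"
    unfolding filterlim_at
    by (auto intro!: tendsto_eq_intros simp: eventually_at_right_less eventually_at intro: exI[of _ 1])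
  then have "filterlim (\<lambda>y. inverse (sqrt y)) at_top (at_right 0)"
    by (rule filterlim_compose[OF filterlim_inverse_at_top_right])
  then show ?thesis
    unfolding divide_inverse
    by (intro filterlim_tendsto_pos_mult_at_top[OF tendsto_const assms])
qed

lemma levy_antideriv_at_0:
  assumes "0 < q"
  shows "(levy_antideriv p q \<longlongrightarrow> 0) (at_right 0)"
proof -
  \<comment> \<open>Stated for every real \<open>c\<close>, so that the instances \<open>p\<close>
    and \<open>- p\<close> serve the two summands.\<close>
  have "filterlim (\<lambda>y. c * sqrt y - q / sqrt y) at_bot (at_right 0)" for c
  proof -
    have "((\<lambda>y. - (c * sqrt y)) \<longlongrightarrow> 0) (at_right 0)"
      by (auto intro!: tendsto_eq_intros)
    then have "filterlim (\<lambda>y. - (c * sqrt y) + q / sqrt y) at_top (at_right 0)"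
      by (rule filterlim_tendsto_add_at_top) (rule filterlim_divide_sqrt_at_right_0[OF assms])
    then show ?thesis
      by (simp add: filterlim_uminus_at_top)
  qed
  from this[of p] this[of "- p"] show ?thesis
    unfolding levy_antideriv_def
    by (auto intro!: tendsto_eq_intros filterlim_compose[OF std_normal_cdf_at_bot])
qed

text \<open>The cases differ in mechanism: for \<open>p = 0\<close> both arguments tend to 0 and
  each summand contributes one half, while for positive \<open>p\<close> the first tends to its full
  weight and the second vanishes. Keeping \<open>p = 0\<close> provides the total mass
  later.\<close>

lemma levy_antideriv_at_top:
  assumes "0 < q" "0 \<le> p"
  shows "(levy_antideriv p q \<longlongrightarrow> exp (- (p * q))) at_top"
proof -
  have q0: "((\<lambda>y. q / sqrt y) \<longlongrightarrow> 0) at_top"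
    by (intro tendsto_divide_0[OF tendsto_const] filterlim_at_top_imp_at_infinity sqrt_at_top)
  show ?thesis
  proof (cases "p = 0")
    case True
    have "((\<lambda>y. std_normal_cdf (0 - q / sqrt y)) \<longlongrightarrow> std_normal_cdf (0 - 0)) at_top"
      by (intro isCont_tendsto_compose[OF std_normal_cdf_isCont] tendsto_diff tendsto_const q0)
    from tendsto_add[OF this this] show ?thesis
      using True by (simp add: levy_antideriv_def[abs_def] std_normal_cdf_zero)
  next
    case False
    then have "filterlim (\<lambda>y. p * sqrt y) at_top at_top"
      using assms by (intro filterlim_tendsto_pos_mult_at_top[OF tendsto_const _ sqrt_at_top]) auto
    note top = filterlim_tendsto_add_at_top[OF _ this]
    from top[OF tendsto_minus[OF q0]] top[OF q0] have "filterlim (\<lambda>y. p * sqrt y - q / sqrt y) at_top at_top"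
      and "filterlim (\<lambda>y. - (p * sqrt y) - q / sqrt y) at_bot at_top"
      by (simp_all add: filterlim_uminus_at_bot add.commute)
    then show ?thesis
      unfolding levy_antideriv_def
      by (auto intro!: tendsto_eq_intros filterlim_compose[OF std_normal_cdf_at_bot]
          filterlim_compose[OF std_normal_cdf_at_top])
  qed
qed

lemma levy_density_laplace:
  assumes "0 < q" "0 \<le> p"
  shows "has_bochner_integral lborel (\<lambda>y. levy_density q y * exp (- (p\<^sup>2 / 2 * y))) (exp (- (p * q)))"
proof -
  have "has_bochner_integral lborel
    (\<lambda>y. indicator (einterval 0 \<infinity>) y *
      (q / sqrt (2 * pi) / (y * sqrt y) * exp (- (q\<^sup>2 / (2 * y))) * exp (- (p\<^sup>2 / 2 * y))))
    (exp (- (p * q)) - 0)"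
  proof (rule interval_FTC_nonneg[where F = "levy_antideriv p q"])
    show "((levy_antideriv p q \<circ> real_of_ereal) \<longlongrightarrow> 0) (at_right 0)"
      using levy_antideriv_at_0[OF assms(1), of p]
      by (simp add: zero_ereal_def ereal_tendsto_simps)
    show "((levy_antideriv p q \<circ> real_of_ereal) \<longlongrightarrow> exp (- (p * q))) (at_left \<infinity>)"
      using levy_antideriv_at_top[OF assms] by (simp add: ereal_tendsto_simps)
    show "(levy_antideriv p q has_real_derivative
      q / sqrt (2 * pi) / (x * sqrt x) * exp (- (q\<^sup>2 / (2 * x))) * exp (- (p\<^sup>2 / 2 * x))) (at x)"
      if "0 < ereal x" for x
      using that by (intro levy_antideriv_deriv) simp
  qed (use assms in \<open>auto intro!: isCont_mult isCont_divide continuous_intros\<close>)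
  then show ?thesis
    by (simp add: levy_density_def zero_ereal_def mult.assoc)
qed

text \<open>At \<open>p = 0\<close> the two halves of the antiderivative coincide, whence the factor
  2.\<close>

lemma levy_density_cdf:
  assumes "0 < q" "0 < y"
  shows "has_bochner_integral lborel (\<lambda>x. indicator {..<y} x * levy_density q x)
    (2 * std_normal_cdf (- (q / sqrt y)))"
proof -
  have "has_bochner_integral lborel
    (\<lambda>x. indicator (einterval 0 y) x *
      (q / sqrt (2 * pi) / (x * sqrt x) * exp (- (q\<^sup>2 / (2 * x))) * exp (- (0\<^sup>2 / 2 * x))))
    (levy_antideriv 0 q y - 0)"
  proof (rule interval_FTC_nonneg[where F = "levy_antideriv 0 q"])
    show "((levy_antideriv 0 q \<circ> real_of_ereal) \<longlongrightarrow> 0) (at_right 0)"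
      using levy_antideriv_at_0[OF assms(1), of 0]
      by (simp add: zero_ereal_def ereal_tendsto_simps)
    have "isCont (levy_antideriv 0 q) y"
      using levy_antideriv_deriv[OF assms(2)] by (rule DERIV_isCont)
    then show "((levy_antideriv 0 q \<circ> real_of_ereal) \<longlongrightarrow> levy_antideriv 0 q y) (at_left (ereal y))"
      by (simp add: ereal_tendsto_simps isCont_def filterlim_at_split)
    show "(levy_antideriv 0 q has_real_derivative
      q / sqrt (2 * pi) / (x * sqrt x) * exp (- (q\<^sup>2 / (2 * x))) * exp (- (0\<^sup>2 / 2 * x))) (at x)"
      if "0 < ereal x" for x
      using that by (intro levy_antideriv_deriv) simp
  qed (use assms in \<open>auto intro!: isCont_mult isCont_divide continuous_intros\<close>)
  moreover have "indicator (einterval 0 y) x * (q / sqrt (2 * pi) / (x * sqrt x) * exp (- (q\<^sup>2 / (2 * x))) * exp (- (0\<^sup>2 / 2 * x)))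
    = indicator {..<y} x * levy_density q x" for x
    by (auto simp: levy_density_def zero_ereal_def indicator_def)
  ultimately show ?thesis
    by (simp add: levy_antideriv_def)
qed

section \<open>Uniqueness of Laplace transforms\<close>

text \<open>Absolute moments are at most 1, so the Taylor remainder of the characteristic function
  is at most \<open>2 * (\<bar>t\<bar> ^ n / fact n)\<close> and vanishes. The characteristic
  functions are therefore limits of the same moment sums.\<close>

lemma bounded_real_distribution_eqI:
  assumes "real_distribution M1" "real_distribution M2"
    and b1: "AE x in M1. \<bar>x\<bar> \<le> 1" and b2: "AE x in M2. \<bar>x\<bar> \<le> 1"
    and moments: "\<And>n. (LINT x|M1. x ^ n) = (LINT x|M2. x ^ n)"
  shows "M1 = M2"
proof (rule Levy_uniqueness[OF assms(1,2)], rule ext, rule LIMSEQ_unique)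
  let ?S = "\<lambda>M t n. \<Sum>k\<le>n. ((\<i> * complex_of_real t) ^ k / fact k) * complex_of_real (LINT x|M. x ^ k)"
  have lim: "(\<lambda>n. ?S M t n) \<longlonglongrightarrow> char M t"
    if "real_distribution M" and b: "AE x in M. \<bar>x\<bar> \<le> 1" for M t
  proof -
    interpret real_distribution M by fact
    have int: "integrable M (\<lambda>x. x ^ k)" "integrable M (\<lambda>x. \<bar>x\<bar> ^ k)" for k
      using b by (auto intro!: integrable_const_bound[of _ 1] elim!: AE_mp
          simp: power_abs power_le_one)
    have bound: "norm (?S M t n - char M t) \<le> 2 * (\<bar>t\<bar> ^ n / fact n)" for n
    proof -
      have "(LINT x|M. \<bar>x\<bar> ^ n) \<le> (LINT x|M. 1)"
        using b int by (intro integral_mono_AE) (auto elim!: AE_mp simp: power_le_one)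
      also have "\<dots> = 1"
        using prob_space by simp
      finally have "(2 * \<bar>t\<bar> ^ n / fact n) * (LINT x|M. \<bar>x\<bar> ^ n) \<le> (2 * \<bar>t\<bar> ^ n / fact n) * 1"
        by (intro mult_left_mono) auto
      with char_approx1[of n t] int show ?thesis
        by (simp add: norm_minus_commute)
    qed
    have "(\<lambda>n. 2 * (\<bar>t\<bar> ^ n / fact n)) \<longlonglongrightarrow> 2 * 0"
      using summable_LIMSEQ_zero[OF summable_exp[of "\<bar>t\<bar>"]]
      by (intro tendsto_mult tendsto_const) (simp add: field_simps)
    then have "(\<lambda>n. 2 * (\<bar>t\<bar> ^ n / fact n)) \<longlonglongrightarrow> 0"
      by simp
    then have "(\<lambda>n. ?S M t n - char M t) \<longlonglongrightarrow> 0"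
      by (rule Lim_null_comparison[OF always_eventually[OF allI[OF bound]]])
    then show ?thesis
      by (simp add: LIM_zero_cancel)
  qed
  fix t
  show "?S M1 t \<longlonglongrightarrow> char M1 t" by (rule lim[OF assms(1) b1])
  show "?S M1 t \<longlonglongrightarrow> char M2 t" unfolding moments by (rule lim[OF assms(2) b2])
qed

text \<open>The values of the Laplace transform at the integers are the moments of \<open>exp (- x)\<close>.\<close>

lemma laplace_transform_unique:
  assumes "real_distribution M1" "real_distribution M2"
    and pos1: "AE x in M1. 0 \<le> x" and pos2: "AE x in M2. 0 \<le> x"
    and laplace: "\<And>\<mu>. 0 < \<mu> \<Longrightarrow> (LINT x|M1. exp (- (\<mu> * x))) = (LINT x|M2. exp (- (\<mu> * x)))"
  shows "M1 = M2"
proof -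
  interpret M1: real_distribution M1 by fact
  interpret M2: real_distribution M2 by fact
  let ?e = "\<lambda>x::real. exp (- x)"
  have "distr M1 borel ?e = distr M2 borel ?e"
  proof (rule bounded_real_distribution_eqI)
    \<comment> \<open>The transforms are compared at positive arguments only; the moment of order 0
      is the total mass on both sides.\<close>
    show "(LINT x|distr M1 borel ?e. x ^ n) = (LINT x|distr M2 borel ?e. x ^ n)" for n
      using laplace[of "real n"] M1.prob_space M2.prob_space
      by (subst (1 2) integral_distr, simp_all, cases "n = 0")
         (simp_all add: exp_of_nat_mult[symmetric])
  qed (use pos1 pos2 in \<open>auto simp: AE_distr_iff\<close>)
  \<comment> \<open>Since \<open>- ln\<close> inverts \<open>exp (- x)\<close>, pushing forward
    again recovers the original laws.\<close>
  then have "distr (distr M1 borel ?e) borel (\<lambda>x. - ln x) = distr (distr M2 borel ?e) borel (\<lambda>x. - ln x)"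
    by simp
  then have "distr M1 borel (\<lambda>x. x) = distr M2 borel (\<lambda>x. x)"
    by (simp add: distr_distr comp_def)
  moreover have "distr M borel (\<lambda>x. x) = M" if "sets M = sets borel" for M :: "real measure"
    using distr_id2[of borel M] that by simp
  ultimately show ?thesis
    by simp
qed

lemma levy_distributed:
  assumes "prob_space M" and X [measurable]: "X \<in> borel_measurable M"
    and pos: "AE \<omega> in M. 0 \<le> X \<omega>" and "0 < s"
    and laplace: "\<And>\<mu>. 0 < \<mu> \<Longrightarrow> (LINT \<omega>|M. exp (- (\<mu> * X \<omega>))) = exp (- (s * sqrt \<mu>))"
  shows "distributed M lborel X (levy_density (s / sqrt 2))"
proof -
  interpret prob_space M by fact
  let ?q = "s / sqrt 2" and ?D = "density lborel (levy_density (s / sqrt 2))"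
  have q: "0 < ?q" using \<open>0 < s\<close> by simp
  have nonneg: "0 \<le> levy_density ?q y" for y
    using q by (intro levy_density_nonneg) simp
  have "has_bochner_integral lborel (levy_density ?q) 1"
    using levy_density_laplace[OF q, of 0] by simp
  then have "(\<integral>\<^sup>+y. levy_density ?q y \<partial>lborel) = 1"
    using nonneg by (simp add: has_bochner_integral_iff nn_integral_eq_integral)
  then have "prob_space ?D"
    by (intro prob_spaceI) (simp add: emeasure_density)
  then have D: "real_distribution ?D"
    by (simp add: real_distribution_def real_distribution_axioms_def)
  have "distr M borel X = ?D"
  proof (rule laplace_transform_unique)
    show "AE x in ?D. 0 \<le> x"
      by (subst AE_density) (auto simp: levy_density_def indicator_def)
    fix \<mu> :: real assume "0 < \<mu>"
    have "(LINT x|?D. exp (- (\<mu> * x))) = (LINT x|lborel. levy_density ?q x * exp (- (\<mu> * x)))"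
      using nonneg by (simp add: integral_density)
    \<comment> \<open>With \<open>p = sqrt (2 * \<mu>)\<close> the rate \<open>p\<^sup>2 / 2\<close>
      is \<open>\<mu>\<close>, and \<open>p * q\<close> with \<open>q = s / sqrt 2\<close> is
      \<open>s * sqrt \<mu>\<close>: this fixes the scale of the density.\<close>
    also have "\<dots> = exp (- (s * sqrt \<mu>))"
      using levy_density_laplace[OF q, of "sqrt (2 * \<mu>)"] \<open>0 < \<mu>\<close>
      by (simp add: has_bochner_integral_iff real_sqrt_mult power_mult_distrib ac_simps)
    finally show "(LINT x|distr M borel X. exp (- (\<mu> * x))) = (LINT x|?D. exp (- (\<mu> * x)))"
      using laplace[OF \<open>0 < \<mu>\<close>] by (simp add: integral_distr)
  qed (use pos D in \<open>auto simp: AE_distr_iff\<close>)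
  then show ?thesis
    using distr_cong[of M M borel lborel X X] by (simp add: distributed_def)
qed

lemma levy_distributed_less:
  assumes "prob_space M" and X: "distributed M lborel X (levy_density q)" and "0 < q" "0 < y"
  shows "measure M {\<omega> \<in> space M. X \<omega> < y} = 2 * std_normal_cdf (- (q / sqrt y))"
proof -
  interpret prob_space M by fact
  have nonneg: "0 \<le> levy_density q x" for x
    using \<open>0 < q\<close> by (intro levy_density_nonneg) simp
  have "emeasure M (X -` {..<y} \<inter> space M) = (\<integral>\<^sup>+x. ennreal (levy_density q x) * indicator {..<y} x \<partial>lborel)"
    by (rule distributed_emeasure[OF X]) simp
  also have "\<dots> = (\<integral>\<^sup>+x. ennreal (indicator {..<y} x * levy_density q x) \<partial>lborel)"
    by (intro nn_integral_cong) (simp add: indicator_def)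
  also have "\<dots> = ennreal (2 * std_normal_cdf (- (q / sqrt y)))"
    using levy_density_cdf[OF assms(3,4)] nonneg
    by (subst nn_integral_eq_integral) (auto simp: has_bochner_integral_iff)
  also have "X -` {..<y} \<inter> space M = {\<omega> \<in> space M. X \<omega> < y}"
    by auto
  finally show ?thesis
    using std_normal_cdf_nonneg by (simp add: measure_def)
qed

section \<open>The law of the first passage time\<close>

text \<open>Right continuity keeps the path below the level just after \<open>s\<close>, and
  monotonicity keeps it below at earlier times, so the infimum clears \<open>s\<close> strictly.
  Reachability of the level excludes the infimum of an empty set; the start below \<open>t\<close>
  settles \<open>s = 0\<close>, which the set leaves out.\<close>

lemma hitting_time_greater_iff:
  assumes mono: "mono_on {0..} (\<lambda>u. X u \<omega>)" and rc: "\<And>u. 0 \<le> u \<Longrightarrow> continuous (at_right u) (\<lambda>u. X u \<omega>)"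
    and "X 0 \<omega> < t" and unb: "\<exists>u>0. t \<le> X u \<omega>" and "0 \<le> s"
  shows "s < hitting_time X t \<omega> \<longleftrightarrow> X s \<omega> < t"
proof
  let ?A = "{s. s > 0 \<and> X s \<omega> \<ge> t}"
  have bdd: "bdd_below ?A" by (rule bdd_belowI[of _ 0]) auto
  {
    assume "s < hitting_time X t \<omega>"
    then have "s \<notin> ?A"
      unfolding hitting_time_def using cInf_lower[OF _ bdd, of s] by force
    with \<open>0 \<le> s\<close> \<open>X 0 \<omega> < t\<close> show "X s \<omega> < t"
      by (cases "s = 0") auto
  }
  assume *: "X s \<omega> < t"
  have "((\<lambda>u. X u \<omega>) \<longlongrightarrow> X s \<omega>) (at_right s)"
    using rc[OF \<open>0 \<le> s\<close>] by (simp add: continuous_within)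
  then have "eventually (\<lambda>u. X u \<omega> < t) (at_right s)"
    using * by (rule order_tendstoD)
  then obtain b where b: "s < b" "\<And>u. s < u \<Longrightarrow> u < b \<Longrightarrow> X u \<omega> < t"
    unfolding eventually_at_right_field by blast
  \<comment> \<open>A lower bound \<open>s\<close> would only give a weak inequality; the midpoint
    leaves room for a strict one.\<close>
  define m where "m = (s + b) / 2"
  have m: "s < m" "m < b" using b(1) by (auto simp: m_def)
  have "m \<le> hitting_time X t \<omega>"
    unfolding hitting_time_def
  proof (rule cInf_greatest)
    fix u assume u: "u \<in> ?A"
    show "m \<le> u"
    proof (rule ccontr)
      assume "\<not> m \<le> u"
      then have "X u \<omega> \<le> X m \<omega>"
        using u by (intro mono_onD[OF mono]) auto
      with b(2)[of m] m u show False by auto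
    qed
  qed (use unb in auto)
  with m show "s < hitting_time X t \<omega>" by simp
qed

text \<open>The total derivative in \<open>s\<close> of one minus the Levy distribution function
  with \<open>q = s / sqrt 2\<close> at the point \<open>(t - s) / (2 * lam)\<^sup>2\<close>. The
  support ends at \<open>t\<close> because of the unit drift.\<close>

definition first_passage_density :: "real \<Rightarrow> real \<Rightarrow> real \<Rightarrow> real" where
  "first_passage_density lam t s = indicator {0<..<t} s *
     (2 * lam / sqrt pi * exp (- (lam\<^sup>2 * s\<^sup>2 / (t - s))) / sqrt (t - s) * (s / (2 * (t - s)) + 1))"

lemma first_passage_density_nonneg: "0 < lam \<Longrightarrow> 0 \<le> first_passage_density lam t s"
  by (auto simp: first_passage_density_def indicator_def)

lemma borel_measurable_first_passage_density [measurable]: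
  "first_passage_density lam t \<in> borel_measurable borel"
  unfolding first_passage_density_def by measurable

text \<open>Origin of the bracket in the theorem: in \<open>s / sqrt (t - s)\<close> the numerator
  contributes the 1 and the denominator contributes \<open>s / (2 * (t - s))\<close>.\<close>

lemma first_passage_cdf_deriv:
  assumes "s < t"
  shows "((\<lambda>s. 1 - 2 * std_normal_cdf (- (sqrt 2 * lam * s / sqrt (t - s)))) has_real_derivative
    2 * lam / sqrt pi * exp (- (lam\<^sup>2 * s\<^sup>2 / (t - s))) / sqrt (t - s) * (s / (2 * (t - s)) + 1)) (at s)"
proof -
  define r where "r = sqrt (t - s)"
  have r: "0 < r" "t - s = r\<^sup>2" using assms by (auto simp: r_def)
  have u: "((\<lambda>s. - (sqrt 2 * lam * s / sqrt (t - s))) has_real_derivative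
      - (sqrt 2 * lam * (1 / r + s / (2 * r ^ 3)))) (at s)"
    using assms r by (auto intro!: derivative_eq_intros simp: field_simps power3_eq_cube power2_eq_square)
  have "((\<lambda>s. 1 - 2 * std_normal_cdf (- (sqrt 2 * lam * s / sqrt (t - s)))) has_real_derivative
     0 - 2 * (std_normal_density (- (sqrt 2 * lam * s / r)) * - (sqrt 2 * lam * (1 / r + s / (2 * r ^ 3))))) (at s)"
    unfolding r_def by (intro DERIV_diff DERIV_const DERIV_cmult std_normal_cdf_chain u[unfolded r_def])
  also have "std_normal_density (- (sqrt 2 * lam * s / r)) = exp (- (lam\<^sup>2 * s\<^sup>2 / r\<^sup>2)) / (sqrt 2 * sqrt pi)"
    by (simp add: normal_density_def power_mult_distrib power_divide real_sqrt_mult)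
  also have "0 - 2 * (exp (- (lam\<^sup>2 * s\<^sup>2 / r\<^sup>2)) / (sqrt 2 * sqrt pi) * - (sqrt 2 * lam * (1 / r + s / (2 * r ^ 3))))
    = 2 * lam / sqrt pi * exp (- (lam\<^sup>2 * s\<^sup>2 / r\<^sup>2)) / r * (s / (2 * r\<^sup>2) + 1)"
    using r by (simp add: power3_eq_cube power2_eq_square field_simps)
  finally show ?thesis
    using r by simp
qed

text \<open>The endpoint \<open>a = t\<close> needs its own value: division by zero being 0, the
  formula would there return 0, whereas the argument really tends to minus infinity and the limit is
  1.\<close>

lemma first_passage_cdf:
  assumes "0 < lam" "0 < t" "0 < a" "a \<le> t"
  shows "has_bochner_integral lborel (\<lambda>s. indicator {..a} s * first_passage_density lam t s)
    (if a < t then 1 - 2 * std_normal_cdf (- (sqrt 2 * lam * a / sqrt (t - a))) else 1)"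
proof -
  let ?F = "\<lambda>s. 1 - 2 * std_normal_cdf (- (sqrt 2 * lam * s / sqrt (t - s)))"
  let ?B = "if a < t then ?F a else 1"
  have "has_bochner_integral lborel (\<lambda>s. indicator (einterval 0 a) s *
    (2 * lam / sqrt pi * exp (- (lam\<^sup>2 * s\<^sup>2 / (t - s))) / sqrt (t - s) * (s / (2 * (t - s)) + 1))) (?B - 0)"
  proof (rule interval_FTC_nonneg[where F = ?F])
    show "(?F has_real_derivative
      2 * lam / sqrt pi * exp (- (lam\<^sup>2 * s\<^sup>2 / (t - s))) / sqrt (t - s) * (s / (2 * (t - s)) + 1)) (at s)"
      if "ereal s < ereal a" for s
      using that assms by (intro first_passage_cdf_deriv) simp
    have "isCont ?F 0"
      by (rule DERIV_isCont[OF first_passage_cdf_deriv]) (use assms in simp)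
    then have "(?F \<longlongrightarrow> ?F 0) (at_right 0)"
      by (simp add: isCont_def filterlim_at_split)
    then show "((?F \<circ> real_of_ereal) \<longlongrightarrow> 0) (at_right 0)"
      by (simp add: zero_ereal_def ereal_tendsto_simps std_normal_cdf_zero)
    have "(?F \<longlongrightarrow> ?B) (at_left a)"
    proof (cases "a < t")
      case True
      then have "isCont ?F a"
        by (intro DERIV_isCont[OF first_passage_cdf_deriv])
      with True show ?thesis
        by (simp add: isCont_def filterlim_at_split)
    next
      case False
      with assms have [simp]: "a = t" by simp
      have "filterlim (\<lambda>s. sqrt (t - s)) (at_right 0) (at_left t)"
        unfolding filterlim_at
        by (auto intro!: tendsto_eq_intros simp: eventually_at_left_field intro: exI[of _ "t - 1"])
      then have "filterlim (\<lambda>s. inverse (sqrt (t - s))) at_top (at_left t)"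
        by (rule filterlim_compose[OF filterlim_inverse_at_top_right])
      then have "filterlim (\<lambda>s. (sqrt 2 * lam * s) * inverse (sqrt (t - s))) at_top (at_left t)"
        by (intro filterlim_tendsto_pos_mult_at_top[where c = "sqrt 2 * lam * t"])
           (use assms in \<open>auto intro!: tendsto_eq_intros\<close>)
      then have "filterlim (\<lambda>s. - (sqrt 2 * lam * s / sqrt (t - s))) at_bot (at_left t)"
        by (simp add: filterlim_uminus_at_bot divide_inverse)
      from filterlim_compose[OF std_normal_cdf_at_bot this] show ?thesis
        by (auto intro!: tendsto_eq_intros)
    qed
    then show "((?F \<circ> real_of_ereal) \<longlongrightarrow> ?B) (at_left (ereal a))"
      by (simp add: ereal_tendsto_simps)
    show "isCont (\<lambda>s. 2 * lam / sqrt pi * exp (- (lam\<^sup>2 * s\<^sup>2 / (t - s))) / sqrt (t - s) * (s / (2 * (t - s)) + 1)) s"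
      if "ereal s < ereal a" for s
      using that assms by (auto intro!: continuous_intros)
  qed (use assms in auto)
  \<comment> \<open>The open interval misses the point \<open>a\<close>, where the density need not
    vanish; hence equality almost everywhere.\<close>
  moreover have "AE s in lborel. indicator (einterval 0 a) s *
    (2 * lam / sqrt pi * exp (- (lam\<^sup>2 * s\<^sup>2 / (t - s))) / sqrt (t - s) * (s / (2 * (t - s)) + 1))
    = indicator {..a} s * first_passage_density lam t s"
    using AE_lborel_singleton[of a]
    by eventually_elim (use assms in \<open>auto simp: first_passage_density_def zero_ereal_def indicator_def\<close>)
  ultimately show ?thesis
    by (subst (asm) has_bochner_integral_cong_AE) auto
qed

lemma first_passage_distributed:
  assumes "prob_space M" "0 < lam" "0 < t" and H: "subordinator M H"
    and laplace: "\<And>t \<mu>. t > 0 \<Longrightarrow> \<mu> > 0 \<Longrightarrow> (LINT \<omega>|M. exp (- (\<mu> * H t \<omega>))) = exp (- (t * sqrt \<mu>))"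
  shows "distributed M lborel (hitting_time (drifted lam H) t) (first_passage_density lam t)"
    and "\<And>\<omega>. \<omega> \<in> space M \<Longrightarrow> hitting_time (drifted lam H) t \<omega> \<in> {0..t}"
proof -
  interpret prob_space M by fact
  let ?L = "hitting_time (drifted lam H) t"
  have Hmeas: "H s \<in> borel_measurable M" if "0 \<le> s" for s
    using H that by (auto simp: subordinator_def)
  have H0: "H 0 \<omega> = 0" and mono: "mono_on {0..} (\<lambda>u. H u \<omega>)"
    and rc: "0 \<le> u \<Longrightarrow> continuous (at_right u) (\<lambda>u. H u \<omega>)" if "\<omega> \<in> space M" for \<omega> u
    using H that by (auto simp: subordinator_def)
  have nonneg: "0 \<le> H s \<omega>" if "\<omega> \<in> space M" "0 \<le> s" for s \<omega>
    using mono_onD[OF mono[OF that(1)], of 0 s] H0 that by simp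
  have greater: "s < ?L \<omega> \<longleftrightarrow> H s \<omega> < (t - s) / (2 * lam)\<^sup>2"
    if \<omega>: "\<omega> \<in> space M" and "0 \<le> s" for s \<omega>
  proof -
    have "s < ?L \<omega> \<longleftrightarrow> drifted lam H s \<omega> < t"
    proof (rule hitting_time_greater_iff)
      show "mono_on {0..} (\<lambda>u. drifted lam H u \<omega>)"
        using mono[OF \<omega>] by (auto simp: drifted_def mono_on_def intro!: add_mono mult_left_mono)
      show "continuous (at_right u) (\<lambda>u. drifted lam H u \<omega>)" if "0 \<le> u" for u
        unfolding drifted_def using rc[OF \<omega> that] by (intro continuous_intros)
      \<comment> \<open>The witness is \<open>t\<close> itself: \<open>H\<close> is nonnegative, so
        the drift alone has reached the level by then.\<close>
      show "\<exists>u>0. t \<le> drifted lam H u \<omega>"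
        using \<open>0 < t\<close> nonneg[OF \<omega>, of t] by (intro exI[of _ t]) (simp add: drifted_def)
    qed (use \<open>0 < t\<close> \<open>0 \<le> s\<close> H0[OF \<omega>] in \<open>auto simp: drifted_def\<close>)
    moreover have "0 < (2 * lam)\<^sup>2"
      using \<open>0 < lam\<close> by simp
    ultimately show ?thesis
      unfolding drifted_def pos_less_divide_eq[OF \<open>0 < (2 * lam)\<^sup>2\<close>] by (simp only: mult.commute) linarith
  qed
  have pos: "0 < ?L \<omega>" if "\<omega> \<in> space M" for \<omega>
    using greater[OF that, of 0] H0[OF that] \<open>0 < t\<close> \<open>0 < lam\<close> by simp
  have le: "?L \<omega> \<le> a" if "\<omega> \<in> space M" "t \<le> a" for \<omega> a
  proof -
    have "0 \<le> a" using that(2) \<open>0 < t\<close> by linarith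
    have "(t - a) / (2 * lam)\<^sup>2 \<le> 0"
      using that(2) by (intro divide_nonpos_nonneg) auto
    also have "0 \<le> H a \<omega>"
      by (rule nonneg[OF that(1) \<open>0 \<le> a\<close>])
    finally show ?thesis
      using greater[OF that(1) \<open>0 \<le> a\<close>] by linarith
  qed
  show "?L \<omega> \<in> {0..t}" if "\<omega> \<in> space M" for \<omega>
    using pos[OF that] le[OF that order_refl] by simp
  have meas [measurable]: "?L \<in> borel_measurable M"
    unfolding borel_measurable_iff_greater
  proof
    fix a
    show "{\<omega> \<in> space M. a < ?L \<omega>} \<in> sets M"
    \<comment> \<open>The equivalence \<open>greater\<close> concerns nonnegative times; below zero
      the event is the whole space by positivity of the passage time.\<close>
    proof (cases "0 \<le> a")
      case True
      have [measurable]: "H a \<in> borel_measurable M" by (rule Hmeas[OF True])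
      have "{\<omega> \<in> space M. a < ?L \<omega>} = {\<omega> \<in> space M. H a \<omega> < (t - a) / (2 * lam)\<^sup>2}"
        using greater[OF _ True] by auto
      then show ?thesis by simp
    next
      case False
      then have "{\<omega> \<in> space M. a < ?L \<omega>} = space M"
        using pos by force
      then show ?thesis by simp
    qed
  qed
  let ?g = "\<lambda>a. if a \<le> 0 then 0
    else if a < t then 1 - 2 * std_normal_cdf (- (sqrt 2 * lam * a / sqrt (t - a))) else 1"
  show "distributed M lborel ?L (first_passage_density lam t)"
  proof (rule distributedI_borel_atMost)
    fix a
    show "(\<integral>\<^sup>+x. ennreal (first_passage_density lam t x * indicator {..a} x) \<partial>lborel) = ennreal (?g a)"
    proof (cases "a \<le> 0")
      case True
      then have zero: "first_passage_density lam t x * indicator {..a} x = 0" for x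
        by (auto simp: first_passage_density_def indicator_def)
      show ?thesis
        unfolding zero using True by simp
    next
      case False
      \<comment> \<open>Truncation at \<open>min a t\<close> brings the bound into the range of
        \<open>first_passage_cdf\<close>; beyond \<open>t\<close> the density is zero.\<close>
      have "(\<integral>\<^sup>+x. ennreal (first_passage_density lam t x * indicator {..a} x) \<partial>lborel)
        = (\<integral>\<^sup>+x. ennreal (indicator {..min a t} x * first_passage_density lam t x) \<partial>lborel)"
        by (intro nn_integral_cong) (auto simp: first_passage_density_def indicator_def)
      also have "\<dots> = ennreal (?g a)"
        using first_passage_cdf[OF assms(2,3), of "min a t"] False \<open>0 < t\<close>
          first_passage_density_nonneg[OF \<open>0 < lam\<close>]
        by (subst nn_integral_eq_integral) (auto simp: has_bochner_integral_iff)
      finally show ?thesis .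
    qed
    have compl: "emeasure M {\<omega> \<in> space M. ?L \<omega> \<le> a} = ennreal (1 - prob {\<omega> \<in> space M. a < ?L \<omega>})"
    proof -
      have "prob {\<omega> \<in> space M. ?L \<omega> \<le> a} = 1 - prob {\<omega> \<in> space M. \<not> ?L \<omega> \<le> a}"
        by (subst prob_neg) auto
      then show ?thesis
        by (simp add: emeasure_eq_measure not_le)
    qed
    show "emeasure M {\<omega> \<in> space M. ?L \<omega> \<le> a} = ennreal (?g a)"
    proof -
      consider "a \<le> 0" | "0 < a" "a < t" | "t \<le> a" by linarith
      then show ?thesis
      proof cases
        case 1
        then have empty: "{\<omega> \<in> space M. ?L \<omega> \<le> a} = {}"
          using pos by force
        show ?thesis
          unfolding empty using 1 by simp
      next
        case 2
        have D: "distributed M lborel (H a) (levy_density (a / sqrt 2))"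
          by (rule levy_distributed) (use 2 nonneg Hmeas laplace in \<open>auto intro: prob_space_axioms\<close>)
        have "prob {\<omega> \<in> space M. a < ?L \<omega>} = prob {\<omega> \<in> space M. H a \<omega> < (t - a) / (2 * lam)\<^sup>2}"
          using greater 2 by (intro arg_cong[where f = prob]) auto
        also have "\<dots> = 2 * std_normal_cdf (- (a / sqrt 2 / sqrt ((t - a) / (2 * lam)\<^sup>2)))"
          by (rule levy_distributed_less[OF prob_space_axioms D]) (use 2 \<open>0 < lam\<close> in auto)
        also have "a / sqrt 2 / sqrt ((t - a) / (2 * lam)\<^sup>2) = sqrt 2 * lam * a / sqrt (t - a)"
        proof -
          have "sqrt ((t - a) / (2 * lam)\<^sup>2) = sqrt (t - a) / (2 * lam)"
            using \<open>0 < lam\<close> by (simp only: real_sqrt_divide real_sqrt_abs)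
          then have "a / sqrt 2 / sqrt ((t - a) / (2 * lam)\<^sup>2) = 2 / sqrt 2 * lam * a / sqrt (t - a)"
            by simp
          then show ?thesis
            by (simp only: real_div_sqrt)
        qed
        finally show ?thesis
          using 2 by (simp add: compl)
      next
        case 3
        then have "{\<omega> \<in> space M. ?L \<omega> \<le> a} = space M"
          using le by auto
        with 3 \<open>0 < t\<close> show ?thesis by (simp add: emeasure_space_1)
      qed
    qed
  qed (use first_passage_density_nonneg[OF \<open>0 < lam\<close>] in auto)
qed

section \<open>Gaussian mixtures and independent time changes\<close>

lemma normal_density_char:
  assumes "0 < \<sigma>"
  shows "(LINT x|lborel. normal_density 0 \<sigma> x *\<^sub>R iexp (\<xi> * x)) = complex_of_real (exp (- (\<sigma>\<^sup>2 * \<xi>\<^sup>2 / 2)))"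
proof -
  have scale: "normal_density 0 \<sigma> (0 + \<sigma> * x) = std_normal_density x / \<sigma>" for x
    using assms by (simp add: normal_density_def power_mult_distrib real_sqrt_mult)
  have "(LINT x|lborel. normal_density 0 \<sigma> x *\<^sub>R iexp (\<xi> * x))
    = \<bar>\<sigma>\<bar> *\<^sub>R (LINT x|lborel. normal_density 0 \<sigma> (0 + \<sigma> * x) *\<^sub>R iexp (\<xi> * (0 + \<sigma> * x)))"
    using assms by (intro lborel_integral_real_affine) simp
  also have "\<dots> = (LINT x|lborel. std_normal_density x *\<^sub>R iexp ((\<xi> * \<sigma>) * x))"
    unfolding scale using assms
    by (subst integral_scaleR_right[symmetric]) (simp add: ac_simps)
  also have "\<dots> = char std_normal_distribution (\<xi> * \<sigma>)"
    unfolding char_def by (subst integral_density) auto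
  finally show ?thesis
    by (simp add: char_std_normal_distribution power_mult_distrib mult.commute)
qed

text \<open>Fubini applies because the norm of the joint integrand integrates over \<open>x\<close>
  to \<open>f s\<close>. For \<open>s \<le> 0\<close> the kernel is not a Gaussian of variance
  \<open>2 * c\<^sup>2 * s\<close>, and the support condition removes it.\<close>

lemma normal_mixture:
  fixes f :: "real \<Rightarrow> real" and c \<xi> :: real
  defines "mix \<equiv> \<lambda>x. LINT s|lborel. f s * normal_density 0 (c * sqrt (2 * s)) x"
  assumes f [measurable]: "f \<in> borel_measurable borel" and nonneg: "\<And>s. 0 \<le> f s"
    and supp: "\<And>s. s \<le> 0 \<Longrightarrow> f s = 0"
    and int_f: "has_bochner_integral lborel f 1" and "0 < c"
  shows "mix \<in> borel_measurable borel" and "real_distribution (density lborel mix)"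
    and "char (density lborel mix) \<xi> = complex_of_real (LINT s|lborel. f s * exp (- (c\<^sup>2 * s * \<xi>\<^sup>2)))"
proof -
  let ?n = "\<lambda>s x. normal_density 0 (c * sqrt (2 * s)) x"
  let ?g = "\<lambda>\<xi> s x. (f s * ?n s x) *\<^sub>R iexp (\<xi> * x)"
  have n_meas [measurable]: "case_prod ?n \<in> borel_measurable (borel \<Otimes>\<^sub>M borel)"
    unfolding normal_density_def by measurable
  show mix_meas [measurable]: "mix \<in> borel_measurable borel"
    unfolding mix_def by measurable
  have mix_nonneg: "0 \<le> mix x" for x
    unfolding mix_def using nonneg by (intro integral_nonneg_AE AE_I2) (auto simp: normal_density_nonneg)
  have inner: "(LINT x|lborel. ?g \<xi> s x) = complex_of_real (f s * exp (- (c\<^sup>2 * s * \<xi>\<^sup>2)))" for s \<xi>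
  proof (cases "0 < s")
    case True
    then have "0 < c * sqrt (2 * s)" using \<open>0 < c\<close> by simp
    note char = normal_density_char[OF this, of \<xi>]
    have "(LINT x|lborel. ?g \<xi> s x) = f s *\<^sub>R (LINT x|lborel. ?n s x *\<^sub>R iexp (\<xi> * x))"
      by (simp only: scaleR_scaleR[symmetric] integral_scaleR_right)
    also have "\<dots> = complex_of_real (f s * exp (- (c\<^sup>2 * s * \<xi>\<^sup>2)))"
      unfolding char using True by (simp add: power_mult_distrib scaleR_conv_of_real)
    finally show ?thesis .
  qed (simp add: supp)
  have int: "integrable (lborel \<Otimes>\<^sub>M lborel) (\<lambda>(s, x). ?g \<xi> s x)" for \<xi>
  proof (rule lborel_pair.Fubini_integrable)
    have "(\<lambda>s. LINT x|lborel. norm (case (s, x) of (s, x) \<Rightarrow> ?g \<xi> s x)) = f"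
    proof
      fix s
      have "(LINT x|lborel. norm (case (s, x) of (s, x) \<Rightarrow> ?g \<xi> s x)) = (LINT x|lborel. f s * ?n s x)"
        using nonneg[of s] by (simp add: abs_mult normal_density_nonneg)
      also have "\<dots> = f s"
        using supp[of s] \<open>0 < c\<close> by (cases "0 < s") simp_all
      finally show "(LINT x|lborel. norm (case (s, x) of (s, x) \<Rightarrow> ?g \<xi> s x)) = f s" .
    qed
    then show "integrable lborel (\<lambda>s. LINT x|lborel. norm (case (s, x) of (s, x) \<Rightarrow> ?g \<xi> s x))"
      using int_f by (simp add: has_bochner_integral_iff)
    show "AE s in lborel. integrable lborel (\<lambda>x. case (s, x) of (s, x) \<Rightarrow> ?g \<xi> s x)"
    proof (rule AE_I2)
      fix s
      have "integrable lborel (\<lambda>x. f s * ?n s x)"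
        using supp[of s] \<open>0 < c\<close> by (cases "0 < s") (auto intro!: integrable_mult_right integrable_normal_density)
      then show "integrable lborel (\<lambda>x. case (s, x) of (s, x) \<Rightarrow> ?g \<xi> s x)"
        by (rule Bochner_Integration.integrable_bound) auto
    qed
  qed measurable
  have int_real: "integrable (lborel \<Otimes>\<^sub>M lborel) (\<lambda>(s, x). f s * ?n s x)"
    using int[of 0, THEN integrable_Re] by (simp add: split_beta')
  have mix_char: "(LINT x|lborel. mix x *\<^sub>R iexp (\<xi> * x)) = complex_of_real (LINT s|lborel. f s * exp (- (c\<^sup>2 * s * \<xi>\<^sup>2)))" for \<xi>
  proof -
    have "(LINT x|lborel. mix x *\<^sub>R iexp (\<xi> * x)) = (LINT x|lborel. LINT s|lborel. ?g \<xi> s x)"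
    proof (rule integral_cong_AE)
      \<comment> \<open>The exponential factor is moved inside the integral where the section is
        integrable, which Fubini guarantees for almost every \<open>x\<close> only.\<close>
      from int_real have "AE x in lborel. integrable lborel (\<lambda>s. f s * ?n s x)"
        by (rule lborel_pair.AE_integrable_snd[where f = "\<lambda>s x. f s * ?n s x"])
      then show "AE x in lborel. mix x *\<^sub>R iexp (\<xi> * x) = (LINT s|lborel. ?g \<xi> s x)"
        by eventually_elim (simp add: mix_def)
    qed measurable
    also have "\<dots> = (LINT s|lborel. LINT x|lborel. ?g \<xi> s x)"
      by (rule lborel_pair.Fubini_integral[OF int])
    also have "\<dots> = complex_of_real (LINT s|lborel. f s * exp (- (c\<^sup>2 * s * \<xi>\<^sup>2)))"
      unfolding inner by (rule integral_complex_of_real)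
    finally show ?thesis .
  qed
  have "integrable lborel mix"
    unfolding mix_def by (rule lborel_pair.integrable_snd[OF int_real])
  \<comment> \<open>The transform at frequency 0 is the total mass.\<close>
  moreover have "integral\<^sup>L lborel mix = 1"
    using mix_char[of 0] int_f by (simp add: has_bochner_integral_iff scaleR_conv_of_real)
  ultimately have "(\<integral>\<^sup>+x. mix x \<partial>lborel) = 1"
    using mix_nonneg by (simp add: nn_integral_eq_integral)
  then have "prob_space (density lborel mix)"
    by (intro prob_spaceI) (simp add: emeasure_density)
  then show "real_distribution (density lborel mix)"
    by (simp add: real_distribution_def real_distribution_axioms_def)
  show "char (density lborel mix) \<xi> = complex_of_real (LINT s|lborel. f s * exp (- (c\<^sup>2 * s * \<xi>\<^sup>2)))"
    unfolding char_def mix_char[symmetric] using mix_nonneg by (subst integral_density) auto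
qed

text \<open>The random time is discretised so that independence is only used at deterministic times;
  path continuity removes the discretisation.\<close>

lemma char_at_independent_time:
  fixes B :: "real \<Rightarrow> 'a \<Rightarrow> real" and \<tau> :: "'a \<Rightarrow> real"
  assumes "prob_space M"
    and B: "\<And>s. 0 \<le> s \<Longrightarrow> B s \<in> borel_measurable M"
    and cont: "\<And>\<omega>. \<omega> \<in> space M \<Longrightarrow> continuous_on {0..} (\<lambda>s. B s \<omega>)"
    and char: "\<And>s. 0 \<le> s \<Longrightarrow> (LINT \<omega>|M. iexp (\<xi> * B s \<omega>)) = complex_of_real (exp (- (s * \<xi>\<^sup>2)))"
    and \<tau> [measurable]: "\<tau> \<in> borel_measurable M"
    and range: "\<And>\<omega>. \<omega> \<in> space M \<Longrightarrow> \<tau> \<omega> \<in> {0..T}"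
    and indep: "\<And>s. 0 \<le> s \<Longrightarrow> prob_space.indep_var M borel (B s) borel \<tau>"
  shows "(\<lambda>\<omega>. B (\<tau> \<omega>) \<omega>) \<in> borel_measurable M"
    and "(LINT \<omega>|M. iexp (\<xi> * B (\<tau> \<omega>) \<omega>)) = complex_of_real (LINT \<omega>|M. exp (- (\<tau> \<omega> * \<xi>\<^sup>2)))"
proof -
  interpret prob_space M by fact
  \<comment> \<open>Rounding down to the grid of mesh \<open>1 / Suc n\<close>; \<open>Suc n\<close>
    keeps the mesh defined at \<open>n = 0\<close>.\<close>
  define K where "K n \<omega> = nat \<lfloor>real (Suc n) * \<tau> \<omega>\<rfloor>" for n \<omega>
  define \<sigma> where "\<sigma> n \<omega> = real (K n \<omega>) / real (Suc n)" for n \<omega>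
  have K_meas [measurable]: "K n \<in> measurable M (count_space UNIV)" for n
    unfolding K_def by measurable
  have \<sigma>_meas [measurable]: "\<sigma> n \<in> borel_measurable M" for n
    unfolding \<sigma>_def by measurable
  have W_meas [measurable]: "(\<lambda>\<omega>. B (\<sigma> n \<omega>) \<omega>) \<in> borel_measurable M" for n
    unfolding \<sigma>_def
    by (rule measurable_compose_countable[where f = "\<lambda>k \<omega>. B (real k / real (Suc n)) \<omega>"]) (auto intro: B)
  have \<sigma>_lim: "(\<lambda>n. \<sigma> n \<omega>) \<longlonglongrightarrow> \<tau> \<omega>" if "\<omega> \<in> space M" for \<omega>
  proof -
    have bound: "norm (\<sigma> n \<omega> - \<tau> \<omega>) \<le> inverse (real (Suc n))" for n
    proof -
      have "0 \<le> real (Suc n) * \<tau> \<omega>"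
        using range[OF that] by simp
      then have "real (K n \<omega>) = of_int \<lfloor>real (Suc n) * \<tau> \<omega>\<rfloor>"
        by (simp add: K_def)
      then have "\<bar>real (K n \<omega>) - real (Suc n) * \<tau> \<omega>\<bar> \<le> 1"
        by linarith
      from mult_right_mono[OF this, of "inverse (real (Suc n))"]
      have "\<bar>(real (K n \<omega>) - real (Suc n) * \<tau> \<omega>) / real (Suc n)\<bar> \<le> inverse (real (Suc n))"
        by (simp add: abs_mult divide_inverse del: of_nat_Suc)
      moreover have "\<sigma> n \<omega> - \<tau> \<omega> = (real (K n \<omega>) - real (Suc n) * \<tau> \<omega>) / real (Suc n)"
        by (simp add: \<sigma>_def diff_divide_distrib del: of_nat_Suc)
      ultimately show ?thesis
        by (simp del: of_nat_Suc)
    qed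
    have "(\<lambda>n. \<sigma> n \<omega> - \<tau> \<omega>) \<longlonglongrightarrow> 0"
      by (rule Lim_null_comparison[OF always_eventually[OF allI[OF bound]] LIMSEQ_inverse_real_of_nat])
    then show ?thesis
      by (rule LIM_zero_cancel)
  qed
  have W_lim: "(\<lambda>n. B (\<sigma> n \<omega>) \<omega>) \<longlonglongrightarrow> B (\<tau> \<omega>) \<omega>" if "\<omega> \<in> space M" for \<omega>
    using range[OF that]
    by (intro continuous_on_tendsto_compose[OF cont[OF that] \<sigma>_lim[OF that]]) (auto simp: \<sigma>_def)
  show W [measurable]: "(\<lambda>\<omega>. B (\<tau> \<omega>) \<omega>) \<in> borel_measurable M"
    by (rule borel_measurable_LIMSEQ_real[OF W_lim W_meas])
  have discrete: "(LINT \<omega>|M. iexp (\<xi> * B (\<sigma> n \<omega>) \<omega>)) = (LINT \<omega>|M. complex_of_real (exp (- (\<sigma> n \<omega> * \<xi>\<^sup>2))))" for n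
  proof -
    let ?N = "nat \<lfloor>real (Suc n) * T\<rfloor>"
    let ?s = "\<lambda>k. real k / real (Suc n)"
    let ?i = "\<lambda>k \<omega>. of_bool (K n \<omega> = k) :: complex"
    \<comment> \<open>The bound \<open>T\<close> on the time makes the decomposition over grid
      points a finite sum.\<close>
    have split: "h (\<sigma> n \<omega>) = (\<Sum>k\<le>?N. h (?s k) * ?i k \<omega>)" if "\<omega> \<in> space M" for \<omega> and h :: "real \<Rightarrow> complex"
    proof -
      have "K n \<omega> \<le> ?N"
        unfolding K_def using range[OF that] by (intro nat_mono floor_mono mult_left_mono) auto
      then show ?thesis
        by (simp add: \<sigma>_def of_bool_def if_distrib[of "\<lambda>x. _ * x"] cong: if_cong)
    qed
    have i_int: "integrable M (?i k)" for k
      by (rule integrable_const_bound[of _ 1]) auto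
    have B_int: "integrable M (\<lambda>\<omega>. iexp (\<xi> * B (?s k) \<omega>))" for k
      using B[of "?s k"] by (intro integrable_const_bound[of _ 1]) auto
    \<comment> \<open>The event of landing on a given grid point is a function of
      \<open>\<tau>\<close> alone, hence independent of \<open>B\<close> at that deterministic
      time.\<close>
    have "indep_var borel ((\<lambda>x. iexp (\<xi> * x)) \<circ> B (?s k)) borel
        ((\<lambda>y. of_bool (nat \<lfloor>real (Suc n) * y\<rfloor> = k) :: complex) \<circ> \<tau>)" for k
      by (rule indep_var_compose[OF indep]) auto
    then have ind: "indep_var borel (\<lambda>\<omega>. iexp (\<xi> * B (?s k) \<omega>)) borel (?i k)" for k
      by (simp add: comp_def K_def)
    have "(LINT \<omega>|M. iexp (\<xi> * B (\<sigma> n \<omega>) \<omega>)) = (LINT \<omega>|M. (\<Sum>k\<le>?N. iexp (\<xi> * B (?s k) \<omega>) * ?i k \<omega>))"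
      using split[of _ "\<lambda>s. iexp (\<xi> * B s _)"] by (intro Bochner_Integration.integral_cong) auto
    also have "\<dots> = (\<Sum>k\<le>?N. (LINT \<omega>|M. iexp (\<xi> * B (?s k) \<omega>) * ?i k \<omega>))"
      by (intro Bochner_Integration.integral_sum indep_var_integrable ind B_int i_int)
    also have "\<dots> = (\<Sum>k\<le>?N. complex_of_real (exp (- (?s k * \<xi>\<^sup>2))) * (LINT \<omega>|M. ?i k \<omega>))"
      by (intro sum.cong refl, subst indep_var_lebesgue_integral[OF ind B_int i_int], subst char) auto
    also have "\<dots> = (LINT \<omega>|M. (\<Sum>k\<le>?N. complex_of_real (exp (- (?s k * \<xi>\<^sup>2))) * ?i k \<omega>))"
      by (subst Bochner_Integration.integral_sum) (auto intro: i_int)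
    also have "\<dots> = (LINT \<omega>|M. complex_of_real (exp (- (\<sigma> n \<omega> * \<xi>\<^sup>2))))"
      using split[of _ "\<lambda>s. complex_of_real (exp (- (s * \<xi>\<^sup>2)))"]
      by (intro Bochner_Integration.integral_cong) auto
    finally show ?thesis .
  qed
  have "(\<lambda>n. LINT \<omega>|M. iexp (\<xi> * B (\<sigma> n \<omega>) \<omega>)) \<longlonglongrightarrow> (LINT \<omega>|M. iexp (\<xi> * B (\<tau> \<omega>) \<omega>))"
  proof (rule integral_dominated_convergence[where w = "\<lambda>_. 1"])
    show "AE \<omega> in M. (\<lambda>n. iexp (\<xi> * B (\<sigma> n \<omega>) \<omega>)) \<longlonglongrightarrow> iexp (\<xi> * B (\<tau> \<omega>) \<omega>)"
      using W_lim by (intro AE_I2 tendsto_intros) auto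
  qed auto
  moreover have "(\<lambda>n. LINT \<omega>|M. complex_of_real (exp (- (\<sigma> n \<omega> * \<xi>\<^sup>2))))
      \<longlonglongrightarrow> (LINT \<omega>|M. complex_of_real (exp (- (\<tau> \<omega> * \<xi>\<^sup>2))))"
  proof (rule integral_dominated_convergence[where w = "\<lambda>_. 1"])
    show "AE \<omega> in M. (\<lambda>n. complex_of_real (exp (- (\<sigma> n \<omega> * \<xi>\<^sup>2)))) \<longlonglongrightarrow> complex_of_real (exp (- (\<tau> \<omega> * \<xi>\<^sup>2)))"
      using \<sigma>_lim by (intro AE_I2 tendsto_intros) auto
  qed (auto simp: \<sigma>_def)
  ultimately have "(LINT \<omega>|M. iexp (\<xi> * B (\<tau> \<omega>) \<omega>)) = (LINT \<omega>|M. complex_of_real (exp (- (\<tau> \<omega> * \<xi>\<^sup>2))))"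
    unfolding discrete by (rule LIMSEQ_unique)
  then show "(LINT \<omega>|M. iexp (\<xi> * B (\<tau> \<omega>) \<omega>)) = complex_of_real (LINT \<omega>|M. exp (- (\<tau> \<omega> * \<xi>\<^sup>2)))"
    by (simp only: integral_complex_of_real)
qed

section \<open>The density of the time-changed Brownian motion\<close>

text \<open>The factor \<open>pi\<close> in the theorem is a product of two roots, one from the
  Gaussian and one from the first-passage density; the 2 in the latter cancels the root of 4 in the
  Gaussian normalisation.\<close>

lemma w1_integrand_eq:
  assumes "0 < c" "0 < lam" "0 < s" "s < t"
  shows "lam / (c * pi) * w1_integrand c lam x t s
    = first_passage_density lam t s * normal_density 0 (c * sqrt (2 * s)) x"
proof -
  define E1 where "E1 = exp (- (lam\<^sup>2 * s\<^sup>2 / (t - s)))"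
  define E2 where "E2 = exp (- (x\<^sup>2 / (4 * c\<^sup>2 * s)))"
  define k where "k = s / (2 * (t - s)) + 1"
  have "sqrt (2 * pi * (c * sqrt (2 * s))\<^sup>2) = sqrt (4 * (pi * c\<^sup>2 * s))"
    using assms by (simp add: power_mult_distrib ac_simps)
  also have "\<dots> = 2 * sqrt pi * c * sqrt s"
    using assms by (simp add: real_sqrt_mult)
  finally have n: "normal_density 0 (c * sqrt (2 * s)) x = 1 / (2 * sqrt pi * c * sqrt s) * E2"
    using assms by (simp add: normal_density_def E2_def power_mult_distrib ac_simps)
  have "w1_integrand c lam x t s = 1 / (sqrt s * sqrt (t - s)) * (E1 * E2) * k"
    by (simp add: w1_integrand_def E1_def E2_def k_def real_sqrt_mult flip: exp_add)
  \<comment> \<open>With the square roots abstracted to variables and \<open>pi\<close> written as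
    \<open>p * p\<close>, the claim is an identity of rational functions.\<close>
  moreover have "lam / (c * (p * p)) * (1 / (u * r) * (E1 * E2) * k)
      = (2 * lam / p * E1 / r * k) * (1 / (2 * p * c * u) * E2)" if "0 < p" "0 < u" "0 < r" for p u r
    using that assms by (simp add: field_simps)
  from this[of "sqrt pi" "sqrt s" "sqrt (t - s)"]
  have "lam / (c * pi) * (1 / (sqrt s * sqrt (t - s)) * (E1 * E2) * k)
      = (2 * lam / sqrt pi * E1 / sqrt (t - s) * k) * (1 / (2 * sqrt pi * c * sqrt s) * E2)"
    using assms by (simp only: real_sqrt_mult_self real_sqrt_gt_0_iff abs_of_pos pi_gt_zero diff_gt_0_iff_gt)
  ultimately have "lam / (c * pi) * w1_integrand c lam x t s
      = (2 * lam / sqrt pi * E1 / sqrt (t - s) * k) * (1 / (2 * sqrt pi * c * sqrt s) * E2)"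
    by (simp only:)
  also have "2 * lam / sqrt pi * E1 / sqrt (t - s) * k = first_passage_density lam t s"
    using assms by (simp add: first_passage_density_def E1_def k_def)
  finally show ?thesis
    unfolding n .
qed

lemma w1_eq_normal_mixture:
  assumes "0 < c" "0 < lam"
  shows "w1 c lam x t = (LINT s|lborel. first_passage_density lam t s * normal_density 0 (c * sqrt (2 * s)) x)"
proof -
  have "w1 c lam x t = (LINT s|lborel. lam / (c * pi) * (indicator {0<..<t} s * w1_integrand c lam x t s))"
    by (simp add: w1_def set_lebesgue_integral_def)
  also have "\<dots> = (LINT s|lborel. first_passage_density lam t s * normal_density 0 (c * sqrt (2 * s)) x)"
  proof (intro Bochner_Integration.integral_cong refl)
    fix s
    show "lam / (c * pi) * (indicator {0<..<t} s * w1_integrand c lam x t s)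
      = first_passage_density lam t s * normal_density 0 (c * sqrt (2 * s)) x"
      using w1_integrand_eq[OF assms, of s t x]
      by (cases "s \<in> {0<..<t}") (auto simp: first_passage_density_def)
  qed
  finally show ?thesis .
qed

lemma first_passage_density_total:
  assumes "0 < lam" "0 < t"
  shows "has_bochner_integral lborel (first_passage_density lam t) 1"
proof -
  have eq: "(\<lambda>s. indicator {..t} s * first_passage_density lam t s) = first_passage_density lam t"
    by (auto simp: first_passage_density_def indicator_def)
  show ?thesis
    using first_passage_cdf[OF assms, of t] assms unfolding eq by simp
qed

text \<open>Near \<open>0\<close> the integrand is dominated by a multiple of \<open>1 / sqrt s\<close>, near \<open>t\<close> by a multiple
  of the first-passage density.\<close>

lemma w1_integrand_integrable:
  assumes "0 < c" "0 < lam" "0 < t"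
  shows "set_integrable lborel {0<..<t} (w1_integrand c lam x t)"
  unfolding set_integrable_def
proof (rule Bochner_Integration.integrable_bound)
  \<comment> \<open>At least one of \<open>s\<close> and \<open>t - s\<close> is no smaller than
    \<open>t / 2\<close>, which gives \<open>sqrt (t / 2)\<close>; the bracket is at most
    \<open>3 / 2\<close> for \<open>s \<le> t / 2\<close>; and \<open>sqrt pi / (2 * lam)\<close>
    undoes the normalisation of the first-passage density.\<close>
  let ?b = "\<lambda>s. 1 / sqrt (t / 2) * (3 / 2 * (indicator (einterval 0 t) s * (1 / sqrt s))
    + sqrt pi / (2 * lam) * first_passage_density lam t s)"
  have "has_bochner_integral lborel (\<lambda>s. indicator (einterval 0 t) s * (1 / sqrt s)) (2 * sqrt t - 2 * sqrt 0)"
  proof (rule interval_FTC_nonneg[where F = "\<lambda>s. 2 * sqrt s"])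
    show "(((\<lambda>s. 2 * sqrt s) \<circ> real_of_ereal) \<longlongrightarrow> 2 * sqrt 0) (at_right 0)"
      unfolding zero_ereal_def ereal_tendsto_simps by (intro tendsto_intros)
    show "(((\<lambda>s. 2 * sqrt s) \<circ> real_of_ereal) \<longlongrightarrow> 2 * sqrt t) (at_left (ereal t))"
      unfolding ereal_tendsto_simps by (intro tendsto_intros)
    show "((\<lambda>s. 2 * sqrt s) has_real_derivative 1 / sqrt s) (at s)" if "0 < ereal s" for s
      using that DERIV_cmult[OF DERIV_real_sqrt, of s 2] by (simp add: inverse_eq_divide)
    show "isCont (\<lambda>s. 1 / sqrt s) s" if "0 < ereal s" for s
      using that by (intro continuous_intros) simp
  qed (use \<open>0 < t\<close> in auto)
  then show "integrable lborel ?b"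
    using first_passage_density_total[OF assms(2,3)]
    by (intro integrable_mult_right Bochner_Integration.integrable_add) (simp_all add: has_bochner_integral_iff)
  show "(\<lambda>s. indicator {0<..<t} s *\<^sub>R w1_integrand c lam x t s) \<in> borel_measurable lborel"
    unfolding w1_integrand_def by measurable
  have "norm (indicator {0<..<t} s *\<^sub>R w1_integrand c lam x t s) \<le> ?b s" for s
  proof (cases "s \<in> {0<..<t}")
    case True
    then have s: "0 < s" "0 < t - s" by auto
    define e where "e = exp (- (lam\<^sup>2 * s\<^sup>2 / (t - s)))"
    define k where "k = s / (2 * (t - s)) + 1"
    have e: "0 < e" "e \<le> 1" using s by (auto simp: e_def)
    have k: "0 < k" using s by (auto simp: k_def add_pos_pos)
    have fp: "sqrt pi / (2 * lam) * first_passage_density lam t s = e / sqrt (t - s) * k"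
      using True \<open>0 < lam\<close> by (simp add: first_passage_density_def e_def k_def)
    have "exp (- (x\<^sup>2 / (4 * c\<^sup>2 * s)) - lam\<^sup>2 * s\<^sup>2 / (t - s)) \<le> e"
      using s \<open>0 < c\<close> by (simp add: e_def)
    then have "w1_integrand c lam x t s \<le> 1 / sqrt (s * (t - s)) * e * k"
      unfolding w1_integrand_def k_def[symmetric] using s k
      by (intro mult_right_mono mult_left_mono) auto
    also have "\<dots> = 1 / sqrt s * (1 / sqrt (t - s)) * e * k"
      by (simp add: real_sqrt_mult)
    also have "\<dots> \<le> 1 / sqrt (t / 2) * (3 / 2 * (1 / sqrt s) + e / sqrt (t - s) * k)"
    proof (cases "s \<le> t / 2")
      case True
      have "k \<le> 3 / 2" using True s by (simp add: k_def field_simps)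
      moreover have "1 / sqrt (t - s) \<le> 1 / sqrt (t / 2)"
        using True s \<open>0 < t\<close> by (intro divide_left_mono) auto
      ultimately have "1 / sqrt s * (1 / sqrt (t - s)) * e * k \<le> 1 / sqrt s * (1 / sqrt (t / 2)) * 1 * (3 / 2)"
        using e k s by (intro mult_mono) auto
      also have "\<dots> = 1 / sqrt (t / 2) * (3 / 2 * (1 / sqrt s))"
        by (simp add: ac_simps)
      also have "\<dots> \<le> 1 / sqrt (t / 2) * (3 / 2 * (1 / sqrt s) + e / sqrt (t - s) * k)"
        using e k s \<open>0 < t\<close> by (intro mult_left_mono) auto
      finally show ?thesis .
    next
      case False
      then have "1 / sqrt s \<le> 1 / sqrt (t / 2)"
        using s \<open>0 < t\<close> by (intro divide_left_mono) auto
      then have "1 / sqrt s * (e / sqrt (t - s) * k) \<le> 1 / sqrt (t / 2) * (e / sqrt (t - s) * k)"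
        using e k s by (intro mult_right_mono) auto
      also have "\<dots> \<le> 1 / sqrt (t / 2) * (3 / 2 * (1 / sqrt s) + e / sqrt (t - s) * k)"
        using s \<open>0 < t\<close> by (intro mult_left_mono) auto
      finally show ?thesis by simp
    qed
    also have "\<dots> = ?b s"
      unfolding fp using True by (simp add: zero_ereal_def)
    finally have "w1_integrand c lam x t s \<le> ?b s" .
    moreover have "0 \<le> w1_integrand c lam x t s"
      using s by (auto simp: w1_integrand_def)
    ultimately show ?thesis
      using True by simp
  qed (use assms in \<open>auto simp: first_passage_density_nonneg zero_ereal_def\<close>)
  then show "AE s in lborel. norm (indicator {0<..<t} s *\<^sub>R w1_integrand c lam x t s) \<le> norm (?b s)"
    unfolding real_norm_def[of "?b _"] by (intro AE_I2 order_trans[OF _ abs_ge_self])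
qed

theorem mainTheorem10:
  fixes M :: "'a measure" and B H :: "real \<Rightarrow> 'a \<Rightarrow> real" and c lam :: real
  assumes "prob_space M"
    and "c > 0" and "lam > 0"
    and "brownian_motion M B"
    and "\<And>t \<xi>. t \<ge> 0 \<Longrightarrow>
      (LINT \<omega>|M. exp (\<i> * complex_of_real (\<xi> * B t \<omega>))) = complex_of_real (exp (- (t * \<xi>\<^sup>2)))"
    and "subordinator M H"
    and "\<And>t \<mu>. t > 0 \<Longrightarrow> \<mu> > 0 \<Longrightarrow> (LINT \<omega>|M. exp (- (\<mu> * H t \<omega>))) = exp (- (t * sqrt \<mu>))"
    and "indep_processes M {0..} B {0<..} (hitting_time (drifted lam H))"
  shows "\<forall>t>0.
    (\<forall>x. set_integrable lborel {0<..<t} (w1_integrand c lam x t)) \<and>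
    distributed M lborel (\<lambda>\<omega>. B (c\<^sup>2 * hitting_time (drifted lam H) t \<omega>) \<omega>) (\<lambda>x. w1 c lam x t)"
proof (intro allI impI conjI)
  interpret prob_space M by fact
  fix t :: real assume "0 < t"
  \<comment> \<open>A non-integrable function would have Bochner integral 0, so this certifies that
    \<open>w1\<close> carries the intended integral for every \<open>x\<close>.\<close>
  show "set_integrable lborel {0<..<t} (w1_integrand c lam x t)" for x
    by (rule w1_integrand_integrable) fact+
  let ?L = "hitting_time (drifted lam H) t"
  let ?f = "first_passage_density lam t"
  have L: "distributed M lborel ?L ?f" "\<And>\<omega>. \<omega> \<in> space M \<Longrightarrow> ?L \<omega> \<in> {0..t}"
    by (rule first_passage_distributed[OF \<open>prob_space M\<close> \<open>lam > 0\<close> \<open>0 < t\<close> \<open>subordinator M H\<close>];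
        simp add: assms(7))+
  have f_nonneg: "0 \<le> ?f s" for s
    by (rule first_passage_density_nonneg) fact
  have L_meas [measurable]: "?L \<in> borel_measurable M"
    using distributed_measurable[OF L(1)] by simp
  \<comment> \<open>Independence of the whole paths is projected to one coordinate on each side; the
    factor \<open>c\<^sup>2\<close> is absorbed into the random time.\<close>
  have indep: "indep_var borel (B s) borel (\<lambda>\<omega>. c\<^sup>2 * ?L \<omega>)" if "0 \<le> s" for s
  proof -
    have "indep_var borel ((\<lambda>b. b s) \<circ> (\<lambda>\<omega>. \<lambda>s\<in>{0..}. B s \<omega>))
        borel ((\<lambda>l. c\<^sup>2 * l t) \<circ> (\<lambda>\<omega>. \<lambda>t\<in>{0<..}. hitting_time (drifted lam H) t \<omega>))"
    proof (rule indep_var_compose[OF assms(8)[unfolded indep_processes_def]])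
      show "(\<lambda>b. b s) \<in> measurable (PiM {0..} (\<lambda>_. borel)) (borel :: real measure)"
        using that by (intro measurable_component_singleton) simp
      have [measurable]: "(\<lambda>l. l t) \<in> measurable (PiM {0<..} (\<lambda>_. borel)) (borel :: real measure)"
        using \<open>0 < t\<close> by (intro measurable_component_singleton) simp
      show "(\<lambda>l. c\<^sup>2 * l t) \<in> measurable (PiM {0<..} (\<lambda>_. borel)) (borel :: real measure)"
        by measurable
    qed
    then show ?thesis
      using that \<open>0 < t\<close> by (simp add: comp_def)
  qed
  have range: "c\<^sup>2 * ?L \<omega> \<in> {0..c\<^sup>2 * t}" if "\<omega> \<in> space M" for \<omega>
    using L(2)[OF that] by (auto intro: mult_left_mono)
  note BM = \<open>brownian_motion M B\<close>[unfolded brownian_motion_def]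
  let ?W = "\<lambda>\<omega>. B (c\<^sup>2 * ?L \<omega>) \<omega>"
  have W: "?W \<in> borel_measurable M"
      "(LINT \<omega>|M. iexp (\<xi> * ?W \<omega>)) = complex_of_real (LINT \<omega>|M. exp (- (c\<^sup>2 * ?L \<omega> * \<xi>\<^sup>2)))" for \<xi>
    by (rule char_at_independent_time[of M B \<xi> "\<lambda>\<omega>. c\<^sup>2 * ?L \<omega>" "c\<^sup>2 * t"];
        use BM assms(1,5) indep range in auto)+
  have f_supp: "?f s = 0" if "s \<le> 0" for s
    using that by (simp add: first_passage_density_def)
  note mix = normal_mixture[OF borel_measurable_first_passage_density f_nonneg f_supp
      first_passage_density_total[OF \<open>lam > 0\<close> \<open>0 < t\<close>] \<open>c > 0\<close>,
      folded w1_eq_normal_mixture[OF \<open>c > 0\<close> \<open>lam > 0\<close>]]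
  have "distr M borel ?W = density lborel (\<lambda>x. w1 c lam x t)"
  proof (rule Levy_uniqueness)
    show "char (distr M borel ?W) = char (density lborel (\<lambda>x. w1 c lam x t))"
    proof
      fix \<xi>
      have "char (distr M borel ?W) \<xi> = (LINT \<omega>|M. iexp (\<xi> * ?W \<omega>))"
        unfolding char_def using W(1) by (simp add: integral_distr)
      also have "\<dots> = complex_of_real (LINT s|lborel. ?f s * exp (- (c\<^sup>2 * s * \<xi>\<^sup>2)))"
        unfolding W(2) using f_nonneg by (subst distributed_integral[OF L(1)]) auto
      also have "\<dots> = char (density lborel (\<lambda>x. w1 c lam x t)) \<xi>"
        by (rule mix(3)[symmetric])
      finally show "char (distr M borel ?W) \<xi> = char (density lborel (\<lambda>x. w1 c lam x t)) \<xi>" .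
    qed
  qed (use W(1) mix(2) in auto)
  then show "distributed M lborel ?W (\<lambda>x. w1 c lam x t)"
    using W(1) mix(1) distr_cong[of M M borel lborel ?W ?W] by (simp add: distributed_def)
qed

end
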